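(* Let $S$ be a Noetherian domain with quotient field $K$. Let $\mathfrak{a}_\bullet$ and $\mathfrak{b}_\bullet$ be graded families of nonzero ideals in $S$. Let $v$ be a valuation of $K$ that is supported on $S$ and such that $\widehat{v}(\mathfrak{b}_\bullet)>0$. Then $$\frac{\widehat{v}(\mathfrak{b}_\bullet)}{\widehat{v}(\mathfrak{a}_\bullet)} \le \widehat{\rho}(\mathfrak{a}_\bullet,\overline{\mathfrak{b}_\bullet}).$$ Moreover, if $\widehat{v}(\mathfrak{a}_\bullet)=0$, then $\widehat{\rho}(\mathfrak{a}_\bullet,\overline{\mathfrak{b}_\bullet})=\infty$.
   Context: $\mathbb{N}$ denotes the positive integers. A graded family of ideals in $S$ is a collection $\mathfrak{a}_\bullet=\{\mathfrak{a}_i\}_{i\ge 1}$ of ideals with $\mathfrak{a}_p\mathfrak{a}_q\subseteq\mathfrak{a}_{p+q}$ for all $p,q\ge 1$. For a graded family $\mathfrak{b}_\bullet$, $\overline{\mathfrak{b}_\bullet}=\{\overline{\mathfrak{b}_i}\}_{i\ge1}$ is the graded family of integral closures. The asymptotic resurgence number of graded families $\mathfrak{a}_\bullet,\mathfrak{b}_\bullet$ is $$\widehat{\rho}(\mathfrak{a}_\bullet,\mathfrak{b}_\bullet)=\sup\left\{\tfrac{s}{r} \mid s,r\in\mathbb{N},\ \mathfrak{a}_{st}\not\subseteq\mathfrak{b}_{rt}\text{ for } t\gg 1\right\},$$ where "for $t\gg1$" means for all sufficiently large $t$; it takes values in the extended reals, with $\sup\varnothing=-\infty$. A valuation of $K$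 is a function $v:K\setminus\{0\}\to\mathbb{Z}$ with $v(xy)=v(x)+v(y)$ and $v(x+y)\ge\min\{v(x),v(y)\}$ (when $x+y\neq0$). It is supported on $S$ if $v(x)\ge0$ for all $x\in S\setminus\{0\}$. For a nonzero ideal $I\subseteq S$, $v(I)=\min\{v(x)\mid x\in I\setminus\{0\}\}$. The skew Waldschmidt constant of a graded family $\mathfrak{a}_\bullet$ of nonzero ideals is $\widehat{v}(\mathfrak{a}_\bullet)=\lim_{n\to\infty}\frac{v(\mathfrak{a}_n)}{n}=\inf_{n\in\mathbb{N}}\frac{v(\mathfrak{a}_n)}{n}$. If $c>0$, the quotient $c/0$ is read as $+\infty$. *)

theory Defs
  imports "HOL-Algebra.Algebra" "HOL-Library.Extended_Real"
begin

text \<open>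
  HOL-Algebra has no field of fractions. \<open>K\<close> is a quotient field of \<open>S\<close> via the embedding \<open>\<iota>\<close>;
  for a subring \<open>S\<close> of \<open>K\<close> one takes \<open>\<iota>\<close> to be the identity.
\<close>

definition quotient_field ::
    "('a, 'm) ring_scheme \<Rightarrow> ('b, 'n) ring_scheme \<Rightarrow> ('a \<Rightarrow> 'b) \<Rightarrow> bool" where
  "quotient_field S K \<iota> \<longleftrightarrow>
     field K \<and> \<iota> \<in> ring_hom S K \<and> inj_on \<iota> (carrier S) \<and>
     (\<forall>x \<in> carrier K. \<exists>a \<in> carrier S. \<exists>b \<in> carrier S - {\<zero>\<^bsub>S\<^esub>}.
        x = \<iota> a \<otimes>\<^bsub>K\<^esub> inv\<^bsub>K\<^esub> (\<iota> b))"

text \<open>Families of ideals are indexed by the positive integers; the value at \<open>0\<close> is never used.\<close>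

definition graded_family :: "('a, 'm) ring_scheme \<Rightarrow> (nat \<Rightarrow> 'a set) \<Rightarrow> bool" where
  "graded_family S \<aa> \<longleftrightarrow>
     (\<forall>p\<ge>1. ideal (\<aa> p) S) \<and>
     (\<forall>p\<ge>1. \<forall>q\<ge>1. ideal_prod S (\<aa> p) (\<aa> q) \<subseteq> \<aa> (p + q))"

text \<open>
  The elements \<open>x\<close> satisfying an equation \<open>x^n + c\<^sub>1 x^(n-1) + \<dots> + c\<^sub>n = 0\<close> with \<open>n \<ge> 1\<close> and \<open>c\<^sub>i \<in> I^i\<close>.
  The powers of \<open>I\<close> are taken in the monoid of ideals of \<open>S\<close>.
\<close>

definition ideal_integral_closure :: "('a, 'm) ring_scheme \<Rightarrow> 'a set \<Rightarrow> 'a set" where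
  "ideal_integral_closure S I =
     {x \<in> carrier S. \<exists>n\<ge>1. \<exists>c :: nat \<Rightarrow> 'a.
        (\<forall>i \<in> {1..n}. c i \<in> I [^]\<^bsub>ideals_set S\<^esub> i) \<and>
        x [^]\<^bsub>S\<^esub> n \<oplus>\<^bsub>S\<^esub> (\<Oplus>\<^bsub>S\<^esub>i\<in>{1..n}. c i \<otimes>\<^bsub>S\<^esub> x [^]\<^bsub>S\<^esub> (n - i)) = \<zero>\<^bsub>S\<^esub>}"

text \<open>The supremum is taken in the extended reals, so that it is \<open>-\<infinity>\<close> for the empty set.\<close>

definition asymptotic_resurgence :: "(nat \<Rightarrow> 'a set) \<Rightarrow> (nat \<Rightarrow> 'a set) \<Rightarrow> ereal" where
  "asymptotic_resurgence \<aa> \<bb> =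
     Sup {ereal (real s / real r) | s r :: nat. s \<ge> 1 \<and> r \<ge> 1 \<and>
            (\<forall>\<^sub>F t in sequentially. \<not> \<aa> (s * t) \<subseteq> \<bb> (r * t))}"

text \<open>Only the values of \<open>v\<close> on the nonzero elements of \<open>K\<close> are relevant.\<close>

definition valuation :: "('b, 'n) ring_scheme \<Rightarrow> ('b \<Rightarrow> int) \<Rightarrow> bool" where
  "valuation K v \<longleftrightarrow>
     (\<forall>x \<in> carrier K - {\<zero>\<^bsub>K\<^esub>}. \<forall>y \<in> carrier K - {\<zero>\<^bsub>K\<^esub>}.
        v (x \<otimes>\<^bsub>K\<^esub> y) = v x + v y \<and>
        (x \<oplus>\<^bsub>K\<^esub> y \<noteq> \<zero>\<^bsub>K\<^esub> \<longrightarrow> v (x \<oplus>\<^bsub>K\<^esub> y) \<ge> min (v x) (v y)))"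

definition supported_on ::
    "('a, 'm) ring_scheme \<Rightarrow> ('a \<Rightarrow> 'b) \<Rightarrow> ('b \<Rightarrow> int) \<Rightarrow> bool" where
  "supported_on S \<iota> v \<longleftrightarrow> (\<forall>x \<in> carrier S - {\<zero>\<^bsub>S\<^esub>}. v (\<iota> x) \<ge> 0)"

text \<open>
  The minimum exists if \<open>I\<close> is nonzero and \<open>v\<close> is supported on \<open>S\<close>. \<open>Min\<close> does not apply,
  as the set of values is infinite in general.
\<close>

definition ideal_value ::
    "('a, 'm) ring_scheme \<Rightarrow> ('a \<Rightarrow> 'b) \<Rightarrow> ('b \<Rightarrow> int) \<Rightarrow> 'a set \<Rightarrow> int" where
  "ideal_value S \<iota> v I = (LEAST n. n \<in> (\<lambda>x. v (\<iota> x)) ` (I - {\<zero>\<^bsub>S\<^esub>}))"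

text \<open>
  For a graded family of nonzero ideals and \<open>v\<close> supported on \<open>S\<close>, the sequence of values is subadditive
  and nonnegative, so by Fekete's lemma the limit exists and equals the infimum over \<open>n \<ge> 1\<close>.
  Quotients of these constants are taken in \<open>ereal\<close>, where \<open>c / 0 = \<infinity>\<close> for \<open>c > 0\<close>.
\<close>

definition skew_waldschmidt ::
    "('a, 'm) ring_scheme \<Rightarrow> ('a \<Rightarrow> 'b) \<Rightarrow> ('b \<Rightarrow> int) \<Rightarrow> (nat \<Rightarrow> 'a set) \<Rightarrow> real" where
  "skew_waldschmidt S \<iota> v \<aa> = lim (\<lambda>n. real_of_int (ideal_value S \<iota> v (\<aa> n)) / real n)"

end

theory Submission
  imports Defs
begin

text \<open>
  The elements of value at least \<open>k\<close> form an ideal, and an equation of integral dependence then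
  shows that passing to the integral closure does not lower the value of an ideal. If \<open>s/r\<close> is
  smaller than the quotient of the two constants, the value of \<open>\<aa>\<^sub>s\<^sub>t\<close> is eventually smaller than
  that of \<open>\<bb>\<^sub>r\<^sub>t\<close>, so an element of minimal value in \<open>\<aa>\<^sub>s\<^sub>t\<close> is not in the integral closure
  of \<open>\<bb>\<^sub>r\<^sub>t\<close>.
\<close>

section \<open>Subadditive sequences\<close>

lemma subadditive_mult_add:
  fixes u :: "nat \<Rightarrow> real"
  assumes subadd: "\<And>p q. p \<ge> 1 \<Longrightarrow> q \<ge> 1 \<Longrightarrow> u (p + q) \<le> u p + u q"
    and "k \<ge> 1" "r \<ge> 1"
  shows "u (q * k + r) \<le> real q * u k + u r"
proof (induction q)
  case (Suc q)
  have "u (k + (q * k + r)) \<le> u k + u (q * k + r)"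
    using assms by (intro subadd) auto
  with Suc show ?case by (simp add: algebra_simps)
qed simp

text \<open>Fekete's lemma. For a fixed \<open>k\<close>, division with remainder
  \<open>n = q * k + r\<close> and subadditivity bound \<open>u n / n\<close> by
  \<open>u k / k\<close> plus a term of order \<open>1 / n\<close>. As \<open>k\<close> is
  arbitrary, the upper limit cannot exceed the infimum.\<close>

lemma fekete:
  fixes u :: "nat \<Rightarrow> real"
  assumes subadd: "\<And>p q. p \<ge> 1 \<Longrightarrow> q \<ge> 1 \<Longrightarrow> u (p + q) \<le> u p + u q"
    and nonneg: "\<And>n. n \<ge> 1 \<Longrightarrow> u n \<ge> 0"
  shows "(\<lambda>n. u n / real n) \<longlonglongrightarrow> (INF n\<in>{1..}. u n / real n)" (is "_ \<longlonglongrightarrow> ?L")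
    and "n \<ge> 1 \<Longrightarrow> (INF n\<in>{1..}. u n / real n) \<le> u n / real n"
proof -
  have bdd: "bdd_below ((\<lambda>n. u n / real n) ` {1..})"
    by (rule bdd_belowI2[where m = 0]) (simp add: nonneg)
  show lower: "?L \<le> u n / real n" if "n \<ge> 1" for n
    using bdd that by (intro cINF_lower) auto
  show "(\<lambda>n. u n / real n) \<longlonglongrightarrow> ?L"
  proof (rule order_tendstoI)
    fix a assume "a < ?L"
    then show "\<forall>\<^sub>F n in sequentially. a < u n / real n"
      using lower by (intro eventually_sequentiallyI[of 1]) (meson less_le_trans)
  next
    fix a assume "?L < a"
    then obtain k where k: "k \<ge> 1" "u k / real k < a"
      using bdd by (subst (asm) cINF_less_iff) auto
    define M where "M = Max (u ` {1..k})"
    have bound: "u n / real n \<le> u k / real k + M / real n" if "n \<ge> 1" for n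
    proof -
      \<comment> \<open>The remainder is shifted into \<open>{1..k}\<close>, since subadditivity
        concerns positive indices only and \<open>u 0\<close> is unconstrained. The maximum
        \<open>M\<close> over this range does not depend on \<open>n\<close>.\<close>
      define q r where "q = (n - 1) div k" and "r = (n - 1) mod k + 1"
      have n: "n = q * k + r" 
        using that by (simp add: q_def r_def)
      have r: "r \<ge> 1" "r \<le> k"
        using k(1) by (simp_all add: r_def Suc_le_eq)
      have "u n \<le> real q * u k + u r"
        using subadditive_mult_add[OF subadd k(1) r(1)] n by simp
      also have "u r \<le> M"
        unfolding M_def using r by (intro Max_ge) auto
      \<comment> \<open>Enlarging \<open>q * k\<close> to \<open>n\<close> preserves the bound
        because \<open>u k\<close> is nonnegative.\<close>
      also have "real q * u k \<le> real n * (u k / real k)"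
      proof -
        have "real q * u k = real (q * k) * (u k / real k)"
          using k(1) by simp
        also have "\<dots> \<le> real n * (u k / real k)"
          using nonneg[OF k(1)] n by (intro mult_right_mono) auto
        finally show ?thesis .
      qed
      finally have "u n \<le> real n * (u k / real k) + M" by simp
      then have "u n / real n \<le> (real n * (u k / real k) + M) / real n"
        by (rule divide_right_mono) simp
      also have "\<dots> = u k / real k + M / real n"
        using that by (simp add: add_divide_distrib)
      finally show ?thesis .
    qed
    have "(\<lambda>n. u k / real k + M / real n) \<longlonglongrightarrow> u k / real k + 0"
      by (intro tendsto_intros lim_const_over_n)
    with k(2) have "\<forall>\<^sub>F n in sequentially. u k / real k + M / real n < a"
      by (intro order_tendstoD(2)) auto
    moreover have "\<forall>\<^sub>F n in sequentially. n \<ge> (1::nat)"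
      by (rule eventually_ge_at_top)
    ultimately show "\<forall>\<^sub>F n in sequentially. u n / real n < a"
      by eventually_elim (use bound in force)
  qed
qed

section \<open>Nonnegative valuations on a domain and integral closure\<close>

locale valued_domain = domain R for R :: "('a, 'm) ring_scheme" (structure) +
  fixes w :: "'a \<Rightarrow> int"
  assumes w_mult: "x \<in> carrier R - {\<zero>} \<Longrightarrow> y \<in> carrier R - {\<zero>} \<Longrightarrow> w (x \<otimes> y) = w x + w y"
    and w_add: "x \<in> carrier R - {\<zero>} \<Longrightarrow> y \<in> carrier R - {\<zero>} \<Longrightarrow> x \<oplus> y \<noteq> \<zero>
      \<Longrightarrow> w (x \<oplus> y) \<ge> min (w x) (w y)"
    and w_nonneg: "x \<in> carrier R - {\<zero>} \<Longrightarrow> w x \<ge> 0"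
begin

definition value_ideal :: "int \<Rightarrow> 'a set" where
  "value_ideal k = {x \<in> carrier R. x = \<zero> \<or> w x \<ge> k}"

lemma value_ideal_carrier: "x \<in> value_ideal k \<Longrightarrow> x \<in> carrier R"
  by (simp add: value_ideal_def)

lemma value_ideal_antimono: "k \<le> l \<Longrightarrow> value_ideal l \<subseteq> value_ideal k"
  by (auto simp: value_ideal_def)

lemma value_ideal_add:
  assumes "x \<in> value_ideal k" "y \<in> value_ideal k"
  shows "x \<oplus> y \<in> value_ideal k"
proof (cases "x = \<zero> \<or> y = \<zero> \<or> x \<oplus> y = \<zero>")
  case True
  with assms show ?thesis by (auto simp: value_ideal_def)
next
  case False
  with assms w_add[of x y] show ?thesis by (auto simp: value_ideal_def)
qed

lemma value_ideal_mult:
  assumes "x \<in> value_ideal k" "y \<in> value_ideal l"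
  shows "x \<otimes> y \<in> value_ideal (k + l)"
proof (cases "x = \<zero> \<or> y = \<zero>")
  case True
  with assms show ?thesis by (auto simp: value_ideal_def)
next
  case False
  with assms w_mult[of x y] show ?thesis by (auto simp: value_ideal_def)
qed

lemma w_one: "w \<one> = 0"
  using w_mult[of \<one> \<one>] by simp

text \<open>Negation is multiplication by \<open>\<ominus> \<one>\<close>, which has value 0 because
  its square is \<open>\<one>\<close>.\<close>

lemma value_ideal_uminus:
  assumes "x \<in> value_ideal k"
  shows "\<ominus> x \<in> value_ideal k"
proof -
  have nz: "\<ominus> \<one> \<noteq> \<zero>"
    using local.minus_minus[of \<one>] by force
  have "\<ominus> \<one> \<otimes> \<ominus> \<one> = \<one>"
    by (simp add: l_minus)
  then have "w (\<ominus> \<one>) = 0"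
    using w_mult[of "\<ominus> \<one>" "\<ominus> \<one>"] nz w_one by simp
  then have "\<ominus> \<one> \<in> value_ideal 0"
    by (simp add: value_ideal_def)
  from value_ideal_mult[OF this assms] show ?thesis
    using value_ideal_carrier[OF assms] by (simp add: l_minus)
qed

lemma value_ideal_finsum:
  assumes "finite A" "\<And>i. i \<in> A \<Longrightarrow> f i \<in> value_ideal k"
  shows "(\<Oplus>i\<in>A. f i) \<in> value_ideal k"
  using assms
proof (induction A rule: finite_induct)
  case empty
  then show ?case by (simp add: value_ideal_def)
next
  case (insert a A)
  then have "f \<in> A \<rightarrow> carrier R" "f a \<in> carrier R"
    by (auto intro: value_ideal_carrier)
  with insert show ?case by (simp add: value_ideal_add)
qed

lemma w_pow:
  assumes "x \<in> carrier R - {\<zero>}"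
  shows "x [^] n \<in> carrier R - {\<zero>}" "w (x [^] (n::nat)) = int n * w x"
proof (induction n)
  case 0
  { case 1 show ?case by simp }
  { case 2 show ?case by (simp add: w_one) }
next
  case (Suc n)
  { case 1 show ?case using Suc assms by (auto simp: integral_iff) }
  { case 2 show ?case using Suc assms by (simp add: w_mult algebra_simps) }
qed

lemma ideal_prod_value_ideal:
  assumes "I \<subseteq> value_ideal k" "J \<subseteq> value_ideal l"
  shows "ideal_prod R I J \<subseteq> value_ideal (k + l)"
proof
  fix x assume "x \<in> ideal_prod R I J"
  then show "x \<in> value_ideal (k + l)"
    by induction (use assms in \<open>auto intro: value_ideal_mult value_ideal_add\<close>)
qed

lemma ideal_power_value_ideal:
  assumes "I \<subseteq> value_ideal k"
  shows "I [^]\<^bsub>ideals_set R\<^esub> (n::nat) \<subseteq> value_ideal (int n * k)"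
proof (induction n)
  case 0
  \<comment> \<open>The zeroth power is the whole ring, so this case rests on the nonnegativity of
    \<open>w\<close>.\<close>
  show ?case
    using w_nonneg by (auto simp: ideals_set_def value_ideal_def)
next
  case (Suc n)
  from ideal_prod_value_ideal[OF Suc assms] show ?case
    by (simp add: ideals_set_def nat_pow_def algebra_simps)
qed

text \<open>If \<open>w x < k\<close>, every term \<open>c i \<otimes> x [^] (n - i)\<close> with
  \<open>i \<ge> 1\<close> has value at least \<open>i * k + (n - i) * w x\<close>, which exceeds
  \<open>n * w x\<close>. The sum of these terms then cannot cancel \<open>x [^] n\<close>.\<close>

lemma integral_closure_value_ideal:
  assumes "I \<subseteq> value_ideal k"
  shows "ideal_integral_closure R I \<subseteq> value_ideal k"
proof
  fix x assume "x \<in> ideal_integral_closure R I"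
  then obtain n c where x: "x \<in> carrier R" and n: "n \<ge> (1::nat)"
    and c: "\<And>i. i \<in> {1..n} \<Longrightarrow> c i \<in> I [^]\<^bsub>ideals_set R\<^esub> i"
    and eq: "x [^] n \<oplus> (\<Oplus>i\<in>{1..n}. c i \<otimes> x [^] (n - i)) = \<zero>"
    unfolding ideal_integral_closure_def by blast
  show "x \<in> value_ideal k"
  proof (rule ccontr)
    assume "x \<notin> value_ideal k"
    with x have nz: "x \<in> carrier R - {\<zero>}" and less: "w x < k"
      by (auto simp: value_ideal_def)
    let ?s = "\<Oplus>i\<in>{1..n}. c i \<otimes> x [^] (n - i)"
    \<comment> \<open>Values are integers, so "greater than \<open>n * w x\<close>" becomes
      membership in a single value ideal, which is closed under finite sums.\<close>
    have "c i \<otimes> x [^] (n - i) \<in> value_ideal (int n * w x + 1)" if i: "i \<in> {1..n}" for i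
    proof -
      have "c i \<in> value_ideal (int i * k)"
        using c[OF i] ideal_power_value_ideal[OF assms] by blast
      moreover have "x [^] (n - i) \<in> value_ideal (int (n - i) * w x)"
        using w_pow[OF nz] by (simp add: value_ideal_def)
      ultimately have "c i \<otimes> x [^] (n - i) \<in> value_ideal (int i * k + int (n - i) * w x)"
        by (rule value_ideal_mult)
      moreover have "int n * w x + 1 \<le> int i * k + int (n - i) * w x"
      proof -
        have "int i * 1 \<le> int i * (k - w x)"
          using less by (intro mult_left_mono) auto
        with i show ?thesis
          by (auto simp: of_nat_diff algebra_simps)
      qed
      ultimately show ?thesis
        using value_ideal_antimono by blast
    qed
    then have s: "?s \<in> value_ideal (int n * w x + 1)"
      by (intro value_ideal_finsum) auto
    have "x [^] n = \<ominus> ?s"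
      using eq x value_ideal_carrier[OF s] by (simp add: sum_zero_eq_neg)
    with value_ideal_uminus[OF s] have "x [^] n \<in> value_ideal (int n * w x + 1)"
      by simp
    with w_pow[OF nz] show False
      by (simp add: value_ideal_def)
  qed
qed

section \<open>The value of an ideal\<close>

definition val :: "'a set \<Rightarrow> int" where
  "val I = (LEAST n. n \<in> w ` (I - {\<zero>}))"

context
  fixes I assumes I: "ideal I R" "I \<noteq> {\<zero>}"
begin

lemma val_eq: "\<exists>n. val I = int n \<and> int n \<in> w ` (I - {\<zero>}) \<and> (\<forall>y\<in>I - {\<zero>}. int n \<le> w y)"
proof -
  interpret ideal I R by (rule I)
  have nonneg: "w y \<ge> 0" if "y \<in> I - {\<zero>}" for y
    using that a_subset by (intro w_nonneg) auto
  obtain x where x: "x \<in> I - {\<zero>}"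
    using I(2) zero_closed by blast
  \<comment> \<open>The integers are not well-ordered, so the least value is first taken over the
    natural numbers, which contain all values because \<open>w\<close> is nonnegative.\<close>
  define n where "n = (LEAST n. int n \<in> w ` (I - {\<zero>}))"
  have "int (nat (w x)) \<in> w ` (I - {\<zero>})"
    using x nonneg[OF x] by auto
  then have n: "int n \<in> w ` (I - {\<zero>})"
    unfolding n_def by (rule LeastI)
  have le: "int n \<le> w y" if y: "y \<in> I - {\<zero>}" for y
  proof -
    have "int (nat (w y)) \<in> w ` (I - {\<zero>})"
      using y nonneg[OF y] by auto
    then have "n \<le> nat (w y)"
      unfolding n_def by (rule Least_le)
    with nonneg[OF y] show ?thesis by simp
  qed
  have "val I = int n"
    unfolding val_def using n le by (intro Least_equality) auto
  with n le show ?thesis by blast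
qed

lemma val_nonneg: "val I \<ge> 0"
  using val_eq by auto

lemma val_attained: "\<exists>x\<in>I - {\<zero>}. w x = val I"
  using val_eq by (metis imageE)

lemma val_le: "x \<in> I - {\<zero>} \<Longrightarrow> val I \<le> w x"
  using val_eq by auto

lemma subset_value_ideal_val: "I \<subseteq> value_ideal (val I)"
proof -
  interpret ideal I R by (rule I)
  show ?thesis
    using val_le a_subset by (auto simp: value_ideal_def)
qed

end

lemma not_subset_integral_closure:
  assumes I: "ideal I R" "I \<noteq> {\<zero>}" and J: "ideal J R" "J \<noteq> {\<zero>}"
    and less: "val I < val J"
  shows "\<not> I \<subseteq> ideal_integral_closure R J"
proof
  assume "I \<subseteq> ideal_integral_closure R J"
  also have "\<dots> \<subseteq> value_ideal (val J)"
    by (intro integral_closure_value_ideal subset_value_ideal_val J)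
  finally show False
    using val_attained[OF I] less by (auto simp: value_ideal_def)
qed

section \<open>Values along graded families\<close>

context
  fixes \<aa> :: "nat \<Rightarrow> 'a set"
  assumes graded: "graded_family R \<aa>" and nonzero: "\<forall>n\<ge>1. \<aa> n \<noteq> {\<zero>}"
begin

lemma graded_family_ideal: "n \<ge> 1 \<Longrightarrow> ideal (\<aa> n) R"
  using graded by (simp add: graded_family_def)

text \<open>Multiply elements of minimal value from the two ideals: in a domain the product is
  nonzero, and its value is the sum.\<close>

lemma val_graded_family_subadditive:
  assumes p: "p \<ge> 1" and q: "q \<ge> 1"
  shows "val (\<aa> (p + q)) \<le> val (\<aa> p) + val (\<aa> q)"
proof -
  obtain x where x: "x \<in> \<aa> p - {\<zero>}" "w x = val (\<aa> p)"
    using val_attained[of "\<aa> p"] graded_family_ideal[OF p] nonzero p by auto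
  obtain y where y: "y \<in> \<aa> q - {\<zero>}" "w y = val (\<aa> q)"
    using val_attained[of "\<aa> q"] graded_family_ideal[OF q] nonzero q by auto
  have carr: "x \<in> carrier R - {\<zero>}" "y \<in> carrier R - {\<zero>}"
    using x y ideal.Icarr[OF graded_family_ideal[OF p]] ideal.Icarr[OF graded_family_ideal[OF q]]
    by auto
  have "x \<otimes> y \<in> ideal_prod R (\<aa> p) (\<aa> q)"
    using x y by (auto intro: ideal_prod.prod)
  then have "x \<otimes> y \<in> \<aa> (p + q)"
    using graded p q unfolding graded_family_def by blast
  with carr have "x \<otimes> y \<in> \<aa> (p + q) - {\<zero>}"
    by (simp add: integral_iff)
  then have "val (\<aa> (p + q)) \<le> w (x \<otimes> y)"
    using p nonzero by (intro val_le graded_family_ideal) auto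
  with x y w_mult[OF carr] show ?thesis by simp
qed

text \<open>Fekete's lemma applied to the values. It shows that the total function
  \<open>lim\<close> denotes an actual limit, and that this limit is the infimum.\<close>

lemma val_graded_family_limit:
  defines "L \<equiv> lim (\<lambda>n. real_of_int (val (\<aa> n)) / real n)"
  shows "(\<lambda>n. real_of_int (val (\<aa> n)) / real n) \<longlonglongrightarrow> L"
    and "n \<ge> 1 \<Longrightarrow> L * real n \<le> real_of_int (val (\<aa> n))"
    and "L \<ge> 0"
proof -
  let ?u = "\<lambda>n. real_of_int (val (\<aa> n))"
  have sub: "?u (p + q) \<le> ?u p + ?u q" if "p \<ge> 1" "q \<ge> 1" for p q
    using val_graded_family_subadditive[OF that] by linarith
  have nonneg: "?u n \<ge> 0" if "n \<ge> 1" for n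
    using val_nonneg[of "\<aa> n"] graded_family_ideal[OF that] nonzero that by simp
  have L: "L = (INF n\<in>{1..}. ?u n / real n)"
    unfolding L_def using fekete(1)[of ?u, OF sub nonneg] by (rule limI)
  show conv: "(\<lambda>n. ?u n / real n) \<longlonglongrightarrow> L"
    unfolding L by (rule fekete(1)[of ?u, OF sub nonneg])
  show "L * real n \<le> ?u n" if "n \<ge> 1"
    using fekete(2)[of ?u, OF sub nonneg that] that unfolding L
    by (simp add: field_simps)
  show "L \<ge> 0"
    unfolding L by (rule cINF_greatest) (use nonneg in auto)
qed

end

text \<open>The two families enter differently: for \<open>\<aa>\<close> convergence along the
  multiples of \<open>s\<close> gives an eventual upper bound, for \<open>\<bb>\<close> the infimum
  gives a lower bound at every index. The condition \<open>s / r < ?c / ?d\<close> is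
  cross-multiplied so that it also covers \<open>?d = 0\<close>.\<close>

lemma eventually_not_subset_integral_closure:
  assumes \<aa>: "graded_family R \<aa>" "\<forall>n\<ge>1. \<aa> n \<noteq> {\<zero>}"
    and \<bb>: "graded_family R \<bb>" "\<forall>n\<ge>1. \<bb> n \<noteq> {\<zero>}"
    and sr: "s \<ge> 1" "r \<ge> 1"
    and less: "real s * lim (\<lambda>n. real_of_int (val (\<aa> n)) / real n)
      < real r * lim (\<lambda>n. real_of_int (val (\<bb> n)) / real n)" (is "_ * ?d < _ * ?c")
  shows "\<forall>\<^sub>F t in sequentially. \<not> \<aa> (s * t) \<subseteq> ideal_integral_closure R (\<bb> (r * t))"
proof -
  have "filterlim (\<lambda>t. s * t) at_top sequentially"
    using sr(1) by (intro mult_nat_left_at_top) simp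
  from filterlim_compose[OF val_graded_family_limit(1)[OF \<aa>] this]
  have "(\<lambda>t. real_of_int (val (\<aa> (s * t))) / real (s * t)) \<longlonglongrightarrow> ?d" .
  moreover have "?d < real r * ?c / real s"
    using less sr(1) by (simp add: field_simps)
  ultimately have "\<forall>\<^sub>F t in sequentially.
      real_of_int (val (\<aa> (s * t))) / real (s * t) < real r * ?c / real s"
    by (rule order_tendstoD(2))
  moreover have "\<forall>\<^sub>F t in sequentially. t \<ge> (1::nat)"
    by (rule eventually_ge_at_top)
  ultimately show ?thesis
  proof eventually_elim
    case (elim t)
    then have st: "s * t \<ge> 1" "r * t \<ge> 1"
      using sr by (simp_all add: Suc_le_eq)
    \<comment> \<open>Multiply by \<open>s * t\<close>: the bound \<open>r * ?c / s\<close> turns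
      into \<open>?c * (r * t)\<close>.\<close>
    from elim sr(1) have "real_of_int (val (\<aa> (s * t))) < ?c * real (r * t)"
      by (simp add: field_simps)
    also have "\<dots> \<le> real_of_int (val (\<bb> (r * t)))"
      by (rule val_graded_family_limit(2)[OF \<bb> st(2)])
    finally show ?case
      using st \<aa> \<bb> by (intro not_subset_integral_closure graded_family_ideal) auto
  qed
qed

end

section \<open>Restricting the valuation from the quotient field\<close>

lemma valued_domain_quotient_field:
  assumes "domain S" "quotient_field S K \<iota>" "valuation K v" "supported_on S \<iota> v"
  shows "valued_domain S (\<lambda>x. v (\<iota> x))"
proof -
  interpret S: domain S by fact
  have "field K" and \<iota>: "\<iota> \<in> ring_hom S K" and inj: "inj_on \<iota> (carrier S)"
    using assms(2) by (auto simp: quotient_field_def)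
  interpret K: field K by fact
  interpret ring_hom_ring S K \<iota>
    using \<iota> by (intro ring_hom_ring.intro ring_hom_ring_axioms.intro S.ring_axioms K.ring_axioms)
  \<comment> \<open>Injectivity of the embedding keeps nonzero elements nonzero, and only there do
    the axioms for \<open>v\<close> say anything.\<close>
  have nz: "\<iota> x \<in> carrier K - {\<zero>\<^bsub>K\<^esub>}" if "x \<in> carrier S - {\<zero>\<^bsub>S\<^esub>}" for x
  proof -
    have "\<iota> x \<noteq> \<iota> \<zero>\<^bsub>S\<^esub>"
      using that inj_onD[OF inj, of x "\<zero>\<^bsub>S\<^esub>"] by blast
    with that show ?thesis by simp
  qed
  show ?thesis
  proof unfold_locales
    fix x y assume xy: "x \<in> carrier S - {\<zero>\<^bsub>S\<^esub>}" "y \<in> carrier S - {\<zero>\<^bsub>S\<^esub>}"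
    then have carr: "x \<in> carrier S" "y \<in> carrier S" by auto
    have v: "v (\<iota> x \<otimes>\<^bsub>K\<^esub> \<iota> y) = v (\<iota> x) + v (\<iota> y) \<and>
        (\<iota> x \<oplus>\<^bsub>K\<^esub> \<iota> y \<noteq> \<zero>\<^bsub>K\<^esub> \<longrightarrow> v (\<iota> x \<oplus>\<^bsub>K\<^esub> \<iota> y) \<ge> min (v (\<iota> x)) (v (\<iota> y)))"
      using assms(3) nz[OF xy(1)] nz[OF xy(2)] unfolding valuation_def by blast
    then show "v (\<iota> (x \<otimes>\<^bsub>S\<^esub> y)) = v (\<iota> x) + v (\<iota> y)"
      using carr by simp
    assume "x \<oplus>\<^bsub>S\<^esub> y \<noteq> \<zero>\<^bsub>S\<^esub>"
    then have "\<iota> (x \<oplus>\<^bsub>S\<^esub> y) \<noteq> \<zero>\<^bsub>K\<^esub>"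
      using nz[of "x \<oplus>\<^bsub>S\<^esub> y"] carr S.add.m_closed by blast
    with v show "v (\<iota> (x \<oplus>\<^bsub>S\<^esub> y)) \<ge> min (v (\<iota> x)) (v (\<iota> y))"
      using carr by simp
  next
    fix x assume "x \<in> carrier S - {\<zero>\<^bsub>S\<^esub>}"
    with assms(4) show "v (\<iota> x) \<ge> 0"
      unfolding supported_on_def by blast
  qed
qed

section \<open>Lower bounds for the asymptotic resurgence\<close>

text \<open>The supremum defining the resurgence runs over fractions of positive integers. Density
  of the rationals carries a bound from such fractions to a real quotient.\<close>

lemma ereal_le_if_positive_fractions_le:
  fixes x :: real
  assumes "x > 0"
    and le: "\<And>s r :: nat. s \<ge> 1 \<Longrightarrow> r \<ge> 1 \<Longrightarrow> real s / real r < x \<Longrightarrow> ereal (real s / real r) \<le> y"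
  shows "ereal x \<le> y"
proof (rule dense_le)
  fix z assume "z < ereal x"
  \<comment> \<open>Taking \<open>max 0 z\<close> forces the rational in between to be positive,
    hence a fraction with positive numerator and denominator; \<open>z\<close> itself may be
    negative or \<open>-\<infinity>\<close>.\<close>
  with assms(1) have "max 0 z < ereal x" by simp
  then obtain q where q: "max 0 z < ereal (real_of_rat q)" "ereal (real_of_rat q) < ereal x"
    using ereal_dense3 by blast
  obtain s r :: nat where r: "r \<noteq> 0" and sr: "\<bar>real_of_rat q\<bar> = real s / real r"
    using Rats_abs_nat_div_natE[OF Rats_of_rat] by metis
  from q(1) have pos: "real_of_rat q > 0" by simp
  with sr have "real_of_rat q = real s / real r" by linarith
  moreover from this pos r have "s \<ge> 1" by (cases s) auto
  ultimately have "ereal (real_of_rat q) \<le> y"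
    using q(2) r le[of s r] by simp
  moreover from q(1) have "z < ereal (real_of_rat q)" by simp
  ultimately show "z \<le> y" by order
qed

theorem theorem2p6:
  fixes S :: "('a, 'm) ring_scheme" and K :: "('b, 'n) ring_scheme"
    and \<iota> :: "'a \<Rightarrow> 'b" and \<aa> \<bb> :: "nat \<Rightarrow> 'a set" and v :: "'b \<Rightarrow> int"
  assumes "noetherian_domain S"
    and "quotient_field S K \<iota>"
    and "graded_family S \<aa>" and "\<forall>n\<ge>1. \<aa> n \<noteq> {\<zero>\<^bsub>S\<^esub>}"
    and "graded_family S \<bb>" and "\<forall>n\<ge>1. \<bb> n \<noteq> {\<zero>\<^bsub>S\<^esub>}"
    and "valuation K v" and "supported_on S \<iota> v"
    and "skew_waldschmidt S \<iota> v \<bb> > 0"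
  shows "ereal (skew_waldschmidt S \<iota> v \<bb>) / ereal (skew_waldschmidt S \<iota> v \<aa>)
           \<le> asymptotic_resurgence \<aa> (\<lambda>n. ideal_integral_closure S (\<bb> n))
       \<and> (skew_waldschmidt S \<iota> v \<aa> = 0 \<longrightarrow>
           asymptotic_resurgence \<aa> (\<lambda>n. ideal_integral_closure S (\<bb> n)) = \<infinity>)"
proof -
  interpret valued_domain S "\<lambda>x. v (\<iota> x)"
    by (rule valued_domain_quotient_field[OF noetherian_domain.axioms(2)[OF assms(1)] assms(2,7,8)])
  let ?\<rho> = "asymptotic_resurgence \<aa> (\<lambda>n. ideal_integral_closure S (\<bb> n))"
  define c d where "c = skew_waldschmidt S \<iota> v \<bb>" and "d = skew_waldschmidt S \<iota> v \<aa>"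
  have skew: "skew_waldschmidt S \<iota> v \<cc> = lim (\<lambda>n. real_of_int (val (\<cc> n)) / real n)" for \<cc>
    by (simp add: skew_waldschmidt_def ideal_value_def val_def)
  have c: "c > 0" and d: "d \<ge> 0"
    using assms(9) val_graded_family_limit(3)[OF assms(3,4)] by (simp_all add: c_def d_def skew)
  have le: "ereal (real s / real r) \<le> ?\<rho>"
    if "s \<ge> 1" "r \<ge> 1" "real s * d < real r * c" for s r :: nat
    unfolding asymptotic_resurgence_def
    using eventually_not_subset_integral_closure[OF assms(3-6) that(1,2)] that
    by (intro Sup_upper) (auto simp: c_def d_def skew)
  have infty: "?\<rho> = \<infinity>" if "d = 0"
  proof (rule ereal_top)
    fix B
    obtain n :: nat where "B \<le> real n"
      using real_arch_simple by blast
    \<comment> \<open>With \<open>d = 0\<close> the condition in \<open>le\<close> reads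
      \<open>0 < r * c\<close>, so every positive integer over 1 is a lower bound;
      \<open>Suc\<close> keeps the numerator positive.\<close>
    then have "ereal B \<le> ereal (real (Suc n) / real 1)"
      by simp
    also have "\<dots> \<le> ?\<rho>"
      by (rule le) (use that c in auto)
    finally show "ereal B \<le> ?\<rho>" .
  qed
  have "ereal c / ereal d \<le> ?\<rho>" if "d > 0"
  proof -
    have "ereal (c / d) \<le> ?\<rho>"
    proof (rule ereal_le_if_positive_fractions_le)
      show "c / d > 0" using c that by simp
      fix s r :: nat assume sr: "s \<ge> 1" "r \<ge> 1" "real s / real r < c / d"
      with that have "real s * d < real r * c"
        by (simp add: field_simps)
      with sr(1,2) show "ereal (real s / real r) \<le> ?\<rho>" by (rule le)
    qed
    with that show ?thesis by simp
  qed
  \<comment> \<open>For \<open>d = 0\<close> the inequality follows from the second claim, as its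
    right-hand side is infinite.\<close>
  with infty d show ?thesis
    by (cases "d = 0") (auto simp: c_def d_def)
qed

end
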